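(* Let $m\ge 2$ be an integer and let $g\colon[0,1]\to\mathbb{R}$ be continuous. Then the convex envelope $u_g^*$ of $g$ on $\mathbb{T}_m$ is the largest solution $u\colon\mathbb{T}_m\to\mathbb{R}$ of $$u(x)=\min\left\{\min_{\substack{y,z\in\mathcal{S}(x)\\ y\neq z}}\frac{u(y)+u(z)}{2}\;;\;\min_{y\in\mathcal{S}(x)}\frac{u(\hat{x})+m\,u(y)}{m+1}\right\}\qquad\text{for all }x\in\mathbb{T}_m$$ that verifies $$\limsup_{x\to\pi}u(x)\le g(\psi(\pi))\qquad\text{for all }\pi\in\partial\mathbb{T}_m.$$ That is, $u_g^*$ satisfies both conditions, and every $u\colon\mathbb{T}_m\to\mathbb{R}$ satisfying both conditions satisfies $u(x)\le u_g^*(x)$ for all $x\in\mathbb{T}_m$. (For $x=\emptyset$ the equation is understood as $u(\emptyset)=\min_{y,z\in\mathcal{S}(\emptyset),\,y\ne z}\frac{u(y)+u(z)}{2}$.)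
   Context: Tree. For an integer $m\ge2$, $\mathbb{T}_m$ is the infinite $m$-branching tree whose vertices are the root $\emptyset$ and all finite sequences $(a_1,\dots,a_k)$, $k\ge1$, with $a_i\in\{0,\dots,m-1\}$. The level of $x=(a_1,\dots,a_k)$ is $|x|=k$, and $|\emptyset|=0$. The successors of $x$ are $\mathcal{S}(x)=\{(x,i): i\in\{0,\dots,m-1\}\}$. If $x\ne\emptyset$, $\hat{x}$ denotes its unique immediate predecessor; vertices are adjacent exactly to their successors and predecessor. Boundary. A branch is an infinite sequence of vertices, each followed by one of its successors, identified with $\pi=(a_1,a_2,\dots)$, $a_k\in\{0,\dots,m-1\}$; $\partial\mathbb{T}_m$ is the set of all branches. Define $\psi(\pi)=\sum_{k=1}^{\infty}a_k m^{-k}\in[0,1]$. For $u\colon\mathbb{T}_m\to\mathbb{R}$ and $\pi=(a_1,a_2,\dots)$, $\lim_{x\to\pi}u(x)$ and $\limsup_{x\to\pi}u(x)$ are the limit and limsup of $u(x_k)$ as $k\to\infty$, where $x_k=(a_1,\dots,a_k)$. Distance. The edge $(\hat{x},x)$ has length $m^{-|x|}$. For vertices $x,y$, $[x,y]$ is the unique minimal path (path with all vertices different) from $x$ to $y$, and $d(x,y)$ is the sum of the lengths of its edges. Convexity. $u\colon\mathbb{T}_m\to\mathbb{R}$ is convex if for all $x\ne y$ in $\mathbb{T}_m$ and all $z\in[x,y]$, $u(z)\le\frac{d(y,z)}{d(x,y)}u(x)+\frac{d(x,z)}{d(x,y)}u(y)$. Convex envelope. For $g\colon[0,1]\to\mathbb{R}$,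 let $\mathcal{C}(g)$ be the set of convex functions $u\colon\mathbb{T}_m\to\mathbb{R}$ with $\limsup_{x\to\pi}u(x)\le g(\psi(\pi))$ for all $\pi\in\partial\mathbb{T}_m$, and $u_g^*(x)=\sup\{u(x):u\in\mathcal{C}(g)\}$. *)

theory Defs
  imports "HOL-Analysis.Analysis" "HOL-Library.Sublist"
begin

section \<open>The tree\<close>

definition vertices :: "nat \<Rightarrow> nat list set" where
  "vertices m = {x. set x \<subseteq> {..<m}}"

definition successors :: "nat \<Rightarrow> nat list \<Rightarrow> nat list set" where
  "successors m x = {x @ [i] | i. i < m}"

text \<open>The predecessor of a non-root vertex is \<^term>\<open>butlast x\<close>.\<close>

definition adjacent :: "nat \<Rightarrow> nat list \<Rightarrow> nat list \<Rightarrow> bool" where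
  "adjacent m x y \<longleftrightarrow> y \<in> successors m x \<or> x \<in> successors m y"

text \<open>Minimal paths: all vertices different.\<close>

definition is_path :: "nat \<Rightarrow> nat list \<Rightarrow> nat list \<Rightarrow> nat list list \<Rightarrow> bool" where
  "is_path m x y p \<longleftrightarrow> p \<noteq> [] \<and> hd p = x \<and> last p = y \<and> set p \<subseteq> vertices m
     \<and> distinct p \<and> successively (adjacent m) p"

definition segment :: "nat \<Rightarrow> nat list \<Rightarrow> nat list \<Rightarrow> nat list list" where
  "segment m x y = (THE p. is_path m x y p)"

text \<open>The length of an edge is \<open>m\<close> to the minus the level of its lower endpoint, i.e. of the
  endpoint of larger level.\<close>

definition edge_length :: "nat \<Rightarrow> nat list \<Rightarrow> nat list \<Rightarrow> real" where
  "edge_length m x y = 1 / real m ^ max (length x) (length y)"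

definition path_length :: "nat \<Rightarrow> nat list list \<Rightarrow> real" where
  "path_length m p = (\<Sum>i<length p - 1. edge_length m (p ! i) (p ! Suc i))"

definition tree_dist :: "nat \<Rightarrow> nat list \<Rightarrow> nat list \<Rightarrow> real" where
  "tree_dist m x y = path_length m (segment m x y)"


section \<open>The boundary\<close>

text \<open>Digits are indexed from 0 here: \<open>\<pi> k\<close> is the digit \<open>a\<^sub>k\<^sub>+\<^sub>1\<close> of the branch.\<close>

definition branches :: "nat \<Rightarrow> (nat \<Rightarrow> nat) set" where
  "branches m = {\<pi>. \<forall>k. \<pi> k < m}"

definition branch_vertex :: "(nat \<Rightarrow> nat) \<Rightarrow> nat \<Rightarrow> nat list" where
  "branch_vertex \<pi> k = map \<pi> [0..<k]"

definition psi :: "nat \<Rightarrow> (nat \<Rightarrow> nat) \<Rightarrow> real" where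
  "psi m \<pi> = (\<Sum>k. real (\<pi> k) / real m ^ Suc k)"

definition boundary_le :: "nat \<Rightarrow> (real \<Rightarrow> real) \<Rightarrow> (nat list \<Rightarrow> real) \<Rightarrow> bool" where
  "boundary_le m g u \<longleftrightarrow>
     (\<forall>\<pi>\<in>branches m. limsup (\<lambda>k. ereal (u (branch_vertex \<pi> k))) \<le> ereal (g (psi m \<pi>)))"


section \<open>Convex functions and the convex envelope\<close>

text \<open>A function on the tree is a function on \<^typ>\<open>nat list\<close> of which only the values on
  \<^term>\<open>vertices m\<close> matter.\<close>

definition tree_convex :: "nat \<Rightarrow> (nat list \<Rightarrow> real) \<Rightarrow> bool" where
  "tree_convex m u \<longleftrightarrow>
     (\<forall>x\<in>vertices m. \<forall>y\<in>vertices m. x \<noteq> y \<longrightarrow>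
        (\<forall>z\<in>set (segment m x y).
           u z \<le> tree_dist m y z / tree_dist m x y * u x + tree_dist m x z / tree_dist m x y * u y))"

definition convex_minorants :: "nat \<Rightarrow> (real \<Rightarrow> real) \<Rightarrow> (nat list \<Rightarrow> real) set" where
  "convex_minorants m g = {u. tree_convex m u \<and> boundary_le m g u}"

text \<open>A real supremum; \<open>convex_minorants_nonempty\<close> and \<open>convex_minorants_bdd_above\<close> below
  show that it is the supremum of a nonempty set that is bounded above.\<close>

definition convex_envelope :: "nat \<Rightarrow> (real \<Rightarrow> real) \<Rightarrow> nat list \<Rightarrow> real" where
  "convex_envelope m g x = (SUP u\<in>convex_minorants m g. u x)"


section \<open>The equation\<close>

definition min_succ_pairs :: "nat \<Rightarrow> (nat list \<Rightarrow> real) \<Rightarrow> nat list \<Rightarrow> real" where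
  "min_succ_pairs m u x =
     Min {(u y + u z) / 2 | y z. y \<in> successors m x \<and> z \<in> successors m x \<and> y \<noteq> z}"

definition min_pred_succ :: "nat \<Rightarrow> (nat list \<Rightarrow> real) \<Rightarrow> nat list \<Rightarrow> real" where
  "min_pred_succ m u x =
     Min {(u (butlast x) + real m * u y) / (real m + 1) | y. y \<in> successors m x}"

definition solves_equation :: "nat \<Rightarrow> (nat list \<Rightarrow> real) \<Rightarrow> bool" where
  "solves_equation m u \<longleftrightarrow>
     (\<forall>x\<in>vertices m.
        u x = (if x = [] then min_succ_pairs m u x
               else min (min_succ_pairs m u x) (min_pred_succ m u x)))"


section \<open>Well-definedness of segments\<close>

lemma adjacent_sym: "adjacent m x y \<longleftrightarrow> adjacent m y x"
  by (auto simp: adjacent_def)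

lemma adjacentE:
  assumes "adjacent m x y"
  obtains "y \<noteq> []" "x = butlast y" | "x \<noteq> []" "y = butlast x"
  using assms by (auto simp: adjacent_def successors_def)

lemma adjacent_butlast:
  assumes "x \<in> vertices m" "x \<noteq> []"
  shows "adjacent m x (butlast x)" "butlast x \<in> vertices m"
proof -
  have "last x < m"
    using assms last_in_set[of x] unfolding vertices_def by blast
  then show "adjacent m x (butlast x)"
    using assms(2) unfolding adjacent_def successors_def
    by (metis (mono_tags, lifting) append_butlast_last_id mem_Collect_eq)
  show "butlast x \<in> vertices m"
    using assms(1) unfolding vertices_def by (auto dest: in_set_butlastD)
qed

lemma is_path_rev: "is_path m x y p \<Longrightarrow> is_path m y x (rev p)"
  by (auto simp: is_path_def hd_rev last_rev adjacent_sym)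

text \<open>A path can leave the subtree below \<open>c\<close> only through the predecessor of \<open>c\<close>.\<close>

lemma path_stays:
  assumes "successively (adjacent m) p" "p \<noteq> []" "c \<noteq> []" "prefix c (hd p)" "butlast c \<notin> set p"
  shows "\<forall>v\<in>set p. prefix c v"
  using assms
proof (induction p)
  case (Cons a p)
  show ?case
  proof (cases p)
    case Nil
    then show ?thesis using Cons.prems by simp
  next
    case (Cons b q)
    have adj: "adjacent m a b" and ca: "prefix c a" and nb: "b \<noteq> butlast c"
      using Cons.prems Cons by auto
    from adj have "prefix c b"
    proof (cases rule: adjacentE)
      case 1
      then show ?thesis using ca by (metis prefix_order.trans prefixeq_butlast)
    next
      case 2
      have "c \<noteq> a" using nb 2 by auto
      then show ?thesis using 2 ca
        by (metis append_butlast_last_id prefix_snoc)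
    qed
    then show ?thesis using Cons.IH Cons.prems Cons by auto
  qed
qed simp

lemma path_through:
  assumes "is_path m a b p" "c \<noteq> []" "prefix c a" "\<not> prefix c b"
  shows "butlast c \<in> set p"
  using path_stays[of m p c] assms unfolding is_path_def by (metis last_in_set)

lemma path_refl: "is_path m x x p \<longleftrightarrow> x \<in> vertices m \<and> p = [x]"
proof
  assume p: "is_path m x x p"
  then obtain q where q: "p = x # q" unfolding is_path_def by (cases p) auto
  then have "q = []" using p unfolding is_path_def by (auto split: if_splits)
  then show "x \<in> vertices m \<and> p = [x]" using p q unfolding is_path_def by auto
qed (auto simp: is_path_def)

lemma path_Cons:
  assumes p: "is_path m x y p" and ne: "x \<noteq> []" "\<not> prefix x y"
  obtains q where "p = x # q" "is_path m (butlast x) y q"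
proof -
  obtain q where q: "p = x # q" using p unfolding is_path_def by (cases p) auto
  have "x \<noteq> y" using ne by auto
  then have qne: "q \<noteq> []" using p q unfolding is_path_def by auto
  then obtain b r where r: "q = b # r" by (cases q) auto
  have pq: "is_path m b y q"
    using p q r unfolding is_path_def by auto
  have xq: "x \<notin> set q" using p q unfolding is_path_def by auto
  have "adjacent m x b" using p q r unfolding is_path_def by auto
  then have "b = butlast x"
  proof (cases rule: adjacentE)
    case 1
    have "\<not> prefix b y" using 1 ne by (metis prefix_order.trans prefixeq_butlast)
    then have False using path_through[OF pq, of b] 1 xq by auto
    then show ?thesis ..
  qed auto
  then show ?thesis using that q pq by auto
qed

lemma prefix_shorter:
  assumes "x \<noteq> y" "length y \<le> length x"
  shows "x \<noteq> []" "\<not> prefix x y"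
  using assms by (auto simp: prefix_def)

lemma path_unique: "is_path m x y p \<Longrightarrow> is_path m x y q \<Longrightarrow> p = q"
proof (induction "length x + length y" arbitrary: x y p q rule: less_induct)
  case less
  have *: "p = q" if p1: "is_path m x y p" and p2: "is_path m x y q" and le: "length y \<le> length x"
    and sz: "length x + length y = n"
    and IH: "\<And>x y p q. length x + length y < n \<Longrightarrow> is_path m x y p \<Longrightarrow> is_path m x y q \<Longrightarrow> p = q"
    for x y p q n
  proof (cases "x = y")
    case True
    then show ?thesis using that path_refl by metis
  next
    case False
    note ne = prefix_shorter[OF False le]
    obtain p' where p': "p = x # p'" "is_path m (butlast x) y p'"
      by (rule path_Cons[OF p1 ne])
    obtain q' where q': "q = x # q'" "is_path m (butlast x) y q'"
      by (rule path_Cons[OF p2 ne])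
    have "length (butlast x) + length y < n" using ne sz by (cases x) auto
    then show ?thesis using IH p' q' by metis
  qed
  show ?case
  proof (cases "length y \<le> length x")
    case True
    then show ?thesis using *[OF less.prems True refl] less.hyps by blast
  next
    case False
    then have "rev p = rev q"
      using *[of y x "rev p" "rev q" "length x + length y"] less.hyps
        is_path_rev[OF less.prems(1)] is_path_rev[OF less.prems(2)]
      by (simp add: add.commute)
    then show ?thesis by simp
  qed
qed

lemma path_exists:
  "x \<in> vertices m \<Longrightarrow> y \<in> vertices m \<Longrightarrow>
     \<exists>p. is_path m x y p \<and> (\<forall>v\<in>set p. prefix v x \<or> prefix v y)"
proof (induction "length x + length y" arbitrary: x y rule: less_induct)
  case less
  have *: "\<exists>p. is_path m x y p \<and> (\<forall>v\<in>set p. prefix v x \<or> prefix v y)"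
    if xy: "x \<in> vertices m" "y \<in> vertices m" "length y \<le> length x"
    and sz: "length x + length y = n"
    and IH: "\<And>x y. length x + length y < n \<Longrightarrow> x \<in> vertices m \<Longrightarrow> y \<in> vertices m \<Longrightarrow>
              \<exists>p. is_path m x y p \<and> (\<forall>v\<in>set p. prefix v x \<or> prefix v y)"
    for x y n
  proof (cases "x = y")
    case True
    then show ?thesis using that path_refl[of m x "[x]"] by auto
  next
    case False
    note ne = prefix_shorter[OF False xy(3)]
    have "length (butlast x) + length y < n" using ne sz by (cases x) auto
    then obtain p where p: "is_path m (butlast x) y p"
        "\<forall>v\<in>set p. prefix v (butlast x) \<or> prefix v y"
      using IH adjacent_butlast[OF xy(1) ne(1)] xy(2) by metis
    have "\<not> prefix x (butlast x)" using ne(1) prefix_length_le[of x "butlast x"] by (cases x) auto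
    then have "x \<notin> set p" using p(2) ne(2) by auto
    then have "is_path m x y (x # p)"
      using p(1) xy(1) adjacent_butlast(1)[OF xy(1) ne(1)] unfolding is_path_def
      by (cases p) auto
    moreover have "\<forall>v\<in>set (x # p). prefix v x \<or> prefix v y"
      using p(2) by (metis prefix_order.refl prefix_order.trans prefixeq_butlast set_ConsD)
    ultimately show ?thesis by blast
  qed
  show ?case
  proof (cases "length y \<le> length x")
    case True
    then show ?thesis using *[OF less.prems True refl] less.hyps by blast
  next
    case False
    then obtain p where "is_path m y x p" "\<forall>v\<in>set p. prefix v y \<or> prefix v x"
      using *[of y x "length x + length y"] less by (auto simp: add.commute)
    then show ?thesis using is_path_rev[of m y x p] by (metis set_rev)
  qed
qed

lemma path_ex1:
  assumes "x \<in> vertices m" "y \<in> vertices m"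
  shows "\<exists>!p. is_path m x y p"
  using path_exists[OF assms] path_unique by blast

lemma segment_is_path:
  assumes "x \<in> vertices m" "y \<in> vertices m"
  shows "is_path m x y (segment m x y)"
  unfolding segment_def using path_ex1[OF assms] by (rule theI')

lemma segment_eq: "is_path m x y p \<Longrightarrow> segment m x y = p"
  unfolding segment_def using path_unique by blast


section \<open>Well-definedness of the convex envelope\<close>

lemma edge_length_sym: "edge_length m x y = edge_length m y x"
  by (simp add: edge_length_def max.commute)

lemma sum_split: "(\<Sum>i<a + b. F i) = (\<Sum>i<a. F i) + (\<Sum>i<b. F (a + i))" for F :: "nat \<Rightarrow> real"
  by (induction b) (simp_all add: add.assoc)

lemma path_length_append:
  "path_length m (p @ [z] @ q) = path_length m (p @ [z]) + path_length m (z # q)"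
proof -
  have "path_length m (p @ [z] @ q)
      = (\<Sum>i<length p + length q. edge_length m ((p @ [z] @ q) ! i) ((p @ [z] @ q) ! Suc i))"
    by (simp add: path_length_def)
  also have "\<dots> = (\<Sum>i<length p. edge_length m ((p @ [z] @ q) ! i) ((p @ [z] @ q) ! Suc i))
      + (\<Sum>i<length q. edge_length m ((p @ [z] @ q) ! (length p + i)) ((p @ [z] @ q) ! Suc (length p + i)))"
    by (rule sum_split)
  also have "(\<Sum>i<length p. edge_length m ((p @ [z] @ q) ! i) ((p @ [z] @ q) ! Suc i))
      = path_length m (p @ [z])"
    unfolding path_length_def by (intro sum.cong) (auto simp: nth_append)
  also have "(\<Sum>i<length q. edge_length m ((p @ [z] @ q) ! (length p + i)) ((p @ [z] @ q) ! Suc (length p + i)))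
      = path_length m (z # q)"
    unfolding path_length_def by (intro sum.cong) (auto simp: nth_append)
  finally show ?thesis .
qed

lemma path_length_nonneg: "0 \<le> path_length m p"
  unfolding path_length_def edge_length_def by (intro sum_nonneg) auto

lemma path_length_rev: "path_length m (rev p) = path_length m p"
proof (induction p)
  case (Cons a p)
  show ?case
  proof (cases p)
    case (Cons b q)
    have "path_length m (rev (a # p)) = path_length m (rev q @ [b] @ [a])" using Cons by simp
    also have "\<dots> = path_length m (rev q @ [b]) + path_length m [b, a]"
      by (rule path_length_append)
    also have "\<dots> = path_length m p + path_length m [a, b]"
      using Cons.IH Cons by (simp add: path_length_def edge_length_sym)
    also have "\<dots> = path_length m (a # p)"
      using path_length_append[of m "[a]" b q] Cons by simp
    finally show ?thesis .
  qed (simp add: path_length_def)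
qed simp

lemma tree_dist_sym:
  assumes "x \<in> vertices m" "y \<in> vertices m"
  shows "tree_dist m x y = tree_dist m y x"
  using segment_eq[OF is_path_rev[OF segment_is_path[OF assms]]]
  by (simp add: tree_dist_def path_length_rev)

lemma tree_dist_pos:
  assumes "m > 0" "x \<in> vertices m" "y \<in> vertices m" "x \<noteq> y"
  shows "tree_dist m x y > 0"
proof -
  let ?p = "segment m x y"
  have p: "is_path m x y ?p" by (rule segment_is_path[OF assms(2,3)])
  have "length ?p - 1 > 0"
  proof (rule ccontr)
    assume "\<not> length ?p - 1 > 0"
    then have "length ?p = 1" using p unfolding is_path_def by (cases ?p) auto
    then show False using p assms(4) unfolding is_path_def by (auto simp: length_Suc_conv)
  qed
  then show ?thesis
    unfolding tree_dist_def path_length_def edge_length_def using assms(1)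
    by (intro sum_pos) (auto simp del: length_greater_0_conv simp: lessThan_empty_iff bot_nat_def)
qed

lemma tree_dist_split:
  assumes "x \<in> vertices m" "y \<in> vertices m" "z \<in> set (segment m x y)"
  shows "z \<in> vertices m" "tree_dist m x y = tree_dist m x z + tree_dist m z y"
proof -
  obtain p q where pq: "segment m x y = p @ [z] @ q"
    using split_list[OF assms(3)] by auto
  have *: "is_path m x y (p @ [z] @ q)" using segment_is_path[OF assms(1,2)] pq by simp
  have "is_path m x z (p @ [z])"
    using * unfolding is_path_def
    by (cases p) (auto simp: successively_append_iff successively_Cons hd_append)
  moreover have "is_path m z y (z # q)"
    using * unfolding is_path_def by (auto simp: successively_append_iff)
  ultimately show "tree_dist m x y = tree_dist m x z + tree_dist m z y"
    using pq segment_eq unfolding tree_dist_def by (metis path_length_append)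
  show "z \<in> vertices m" using * unfolding is_path_def by auto
qed

lemma convexity_weights:
  assumes "m > 0" "x \<in> vertices m" "y \<in> vertices m" "x \<noteq> y" "z \<in> set (segment m x y)"
  shows "0 \<le> tree_dist m y z / tree_dist m x y" "0 \<le> tree_dist m x z / tree_dist m x y"
    and "tree_dist m y z / tree_dist m x y + tree_dist m x z / tree_dist m x y = 1"
proof -
  note z = tree_dist_split[OF assms(2,3,5)]
  have "tree_dist m x y > 0" by (rule tree_dist_pos[OF assms(1-4)])
  then show "0 \<le> tree_dist m y z / tree_dist m x y" "0 \<le> tree_dist m x z / tree_dist m x y"
    by (auto simp: tree_dist_def path_length_nonneg)
  show "tree_dist m y z / tree_dist m x y + tree_dist m x z / tree_dist m x y = 1"
    using z(2) tree_dist_sym[OF assms(3) z(1)] \<open>tree_dist m x y > 0\<close>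
    by (simp add: add_divide_distrib[symmetric])
qed

lemma psi_in_unit:
  assumes "m \<ge> 2" "\<pi> \<in> branches m"
  shows "summable (\<lambda>k. real (\<pi> k) / real m ^ Suc k)" "psi m \<pi> \<in> {0..1}"
proof -
  let ?f = "\<lambda>k. real (\<pi> k) / real m ^ Suc k" and ?h = "\<lambda>k. (real m - 1) / real m * (1 / real m) ^ k"
  have "(\<lambda>k. (1 / real m) ^ k) sums (1 / (1 - 1 / real m))"
    by (rule geometric_sums) (use assms(1) in auto)
  then have "?h sums ((real m - 1) / real m * (1 / (1 - 1 / real m)))"
    by (rule sums_mult)
  moreover have "(real m - 1) / real m * (1 / (1 - 1 / real m)) = 1"
    using assms(1) by (simp add: field_simps)
  ultimately have h: "?h sums 1" by metis
  have le: "?f k \<le> ?h k" for k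
  proof -
    have "\<pi> k < m" using assms(2) unfolding branches_def by auto
    then have "real (\<pi> k) \<le> real m - 1" by linarith
    then have "?f k \<le> (real m - 1) / real m ^ Suc k" by (rule divide_right_mono) auto
    then show ?thesis by (simp add: power_one_over field_simps)
  qed
  show s: "summable ?f"
    by (rule summable_comparison_test'[OF sums_summable[OF h], of 0]) (use le in auto)
  have "psi m \<pi> \<le> 1"
    unfolding psi_def using suminf_le[OF le s sums_summable[OF h]] sums_unique[OF h] by simp
  moreover have "0 \<le> psi m \<pi>" unfolding psi_def by (rule suminf_nonneg[OF s]) auto
  ultimately show "psi m \<pi> \<in> {0..1}" by simp
qed

lemma convex_minorants_nonempty:
  assumes "m \<ge> 2" "continuous_on {0..1} g"
  shows "convex_minorants m g \<noteq> {}"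
proof -
  obtain c where c: "\<forall>t\<in>{0..1}. g c \<le> g t"
    using continuous_attains_inf[of "{0..1::real}" g] assms(2) by auto
  have "tree_convex m (\<lambda>_. g c)"
    unfolding tree_convex_def distrib_right[symmetric]
    using convexity_weights(3)[of m] assms(1) by simp
  moreover have "boundary_le m g (\<lambda>_. g c)"
    unfolding boundary_le_def using c psi_in_unit(2)[OF assms(1)] by (simp add: Limsup_const)
  ultimately show ?thesis unfolding convex_minorants_def by blast
qed

lemma convex_minorants_bdd_above:
  assumes "m \<ge> 2" "continuous_on {0..1} g" "x \<in> vertices m"
  shows "bdd_above ((\<lambda>u. u x) ` convex_minorants m g)"
proof -
  obtain c where c: "\<forall>t\<in>{0..1}. g t \<le> g c"
    using continuous_attains_sup[of "{0..1::real}" g] assms(2) by auto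
  define M where "M = g c + 1"
  have "u x \<le> M" if u: "u \<in> convex_minorants m g" for u
  proof -
    define \<beta> where "\<beta> j k = (if k < length x then x ! k else j)" for j k :: nat
    have br: "\<beta> j \<in> branches m" if "j < m" for j
      using assms(3) that nth_mem[of _ x] unfolding \<beta>_def branches_def vertices_def
      by (simp add: subset_iff)
    have pre: "prefix (x @ [j]) (branch_vertex (\<beta> j) k)" and ver: "branch_vertex (\<beta> j) k \<in> vertices m"
      if "j < m" "k > length x" for j k
    proof -
      have "take (Suc (length x)) (branch_vertex (\<beta> j) k) = x @ [j]"
        using that by (intro nth_equalityI) (auto simp: branch_vertex_def \<beta>_def nth_append less_Suc_eq)
      then show "prefix (x @ [j]) (branch_vertex (\<beta> j) k)" by (metis take_is_prefix)
      show "branch_vertex (\<beta> j) k \<in> vertices m"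
        using br[OF that(1)] unfolding branch_vertex_def branches_def vertices_def by auto
    qed
    have ev: "eventually (\<lambda>k. u (branch_vertex (\<beta> j) k) < M) sequentially" if "j < m" for j
    proof -
      have "limsup (\<lambda>k. ereal (u (branch_vertex (\<beta> j) k))) \<le> ereal (g (psi m (\<beta> j)))"
        using u br[OF that] unfolding convex_minorants_def boundary_le_def by auto
      also have "\<dots> < ereal M"
        using bspec[OF c psi_in_unit(2)[OF assms(1) br[OF that]]] unfolding M_def by simp
      finally show ?thesis using Limsup_lessD by fastforce
    qed
    have "eventually (\<lambda>k. u (branch_vertex (\<beta> 0) k) < M \<and> u (branch_vertex (\<beta> 1) k) < M
        \<and> length x < k) sequentially"
      using ev[of 0] ev[of 1] assms(1) eventually_gt_at_top[of "length x"]
      by (auto intro!: eventually_conj)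
    then obtain k where k: "u (branch_vertex (\<beta> 0) k) < M" "u (branch_vertex (\<beta> 1) k) < M" "length x < k"
      by (auto simp: eventually_sequentially)
    define a b where "a = branch_vertex (\<beta> 0) k" and "b = branch_vertex (\<beta> 1) k"
    have ab: "a \<in> vertices m" "b \<in> vertices m" "prefix (x @ [0]) a" "prefix (x @ [1]) b"
      using pre ver k(3) assms(1) unfolding a_def b_def by auto
    have n: "\<not> prefix (x @ [0]) b"
      using ab(4) by (auto simp: prefix_def)
    then have "a \<noteq> b" using ab by auto
    have xs: "x \<in> set (segment m a b)"
      using path_through[OF segment_is_path[OF ab(1,2)] _ ab(3) n] by simp
    note w = convexity_weights[OF _ ab(1,2) \<open>a \<noteq> b\<close> xs]
    have "u x \<le> tree_dist m b x / tree_dist m a b * u a + tree_dist m a x / tree_dist m a b * u b"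
      using u ab \<open>a \<noteq> b\<close> xs unfolding convex_minorants_def tree_convex_def by auto
    also have "\<dots> \<le> tree_dist m b x / tree_dist m a b * M + tree_dist m a x / tree_dist m a b * M"
      using w assms(1) k unfolding a_def[symmetric] b_def[symmetric]
      by (intro add_mono mult_left_mono) auto
    also have "\<dots> = M" unfolding distrib_right[symmetric] using w(3) assms(1) by simp
    finally show ?thesis .
  qed
  then show ?thesis by (intro bdd_aboveI2[of _ _ M])
qed

end

theory Submission
  imports Defs
begin

text \<open>
  Convexity on a tree is a local property: since any two vertices are joined by a single path,
  a function is convex as soon as it is convex on every path of two edges
  (\<open>tree_convex_iff_locally_convex\<close>), and with the given edge lengths these inequalities
  say exactly that \<open>u x \<le> neighbour_min m u x\<close>, where \<open>neighbour_min\<close> is the right-hand side of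
  the equation (\<open>locally_convex_iff_neighbour_min\<close>). So convex functions are the
  subsolutions of the equation, and the theorem is Perron's method: the supremum of all
  subsolutions below the boundary datum is the largest solution.

  The right-hand side is monotone in \<open>u\<close>, so the envelope is itself a subsolution.
  It is a solution because \<open>neighbour_min m u x\<close> does not involve the value at \<open>x\<close>: if the
  inequality were strict at \<open>x\<close>, raising the envelope at the single vertex \<open>x\<close> to the right-hand
  side would give a subsolution with the same behaviour at the boundary, which is larger than
  the supremum. Every solution is a subsolution, hence lies below the envelope.

  That the envelope still has the right boundary values needs a bound that is uniform over all
  competitors. From each vertex, a subsolution does not decrease towards at least one successor;
  following these successors from \<open>x\<close> shows that \<open>u x \<le> g (psi m \<beta>)\<close> for some
  branch \<open>\<beta>\<close> through \<open>x\<close> (\<open>convex_minorant_le_boundary_value\<close>). Branches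
  through a common vertex of level \<open>k\<close> have values of \<open>psi\<close> at distance at most
  \<open>1 / m ^ k\<close>, so that continuity of \<open>g\<close> finishes the argument.
\<close>

section \<open>Convexity is local\<close>

text \<open>Convexity on two consecutive edges, with denominators cleared.\<close>

definition locally_convex :: "nat \<Rightarrow> (nat list \<Rightarrow> real) \<Rightarrow> bool" where
  "locally_convex m u \<longleftrightarrow>
     (\<forall>a\<in>vertices m. \<forall>b\<in>vertices m. \<forall>c\<in>vertices m.
        adjacent m a b \<longrightarrow> adjacent m b c \<longrightarrow> a \<noteq> c \<longrightarrow>
          u b * (edge_length m a b + edge_length m b c)
            \<le> edge_length m b c * u a + edge_length m a b * u c)"

lemma adjacent_neq: "adjacent m x y \<Longrightarrow> x \<noteq> y"
  by (auto simp: adjacent_def successors_def)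

lemma edge_length_pos: "m > 0 \<Longrightarrow> edge_length m x y > 0"
  by (simp add: edge_length_def)

lemma tree_dist_adjacent:
  assumes "x \<in> vertices m" "y \<in> vertices m" "adjacent m x y"
  shows "tree_dist m x y = edge_length m x y"
proof -
  have "is_path m x y [x, y]"
    using assms adjacent_neq[OF assms(3)] by (simp add: is_path_def)
  then show ?thesis by (simp add: tree_dist_def segment_eq path_length_def)
qed

lemma tree_convex_imp_locally_convex:
  assumes "m > 0" "tree_convex m u"
  shows "locally_convex m u"
  unfolding locally_convex_def
proof (intro ballI impI)
  fix a b c
  assume v: "a \<in> vertices m" "b \<in> vertices m" "c \<in> vertices m"
    and adj: "adjacent m a b" "adjacent m b c" and ac: "a \<noteq> c"
  have "is_path m a c [a, b, c]"
    using v adj ac adjacent_neq[OF adj(1)] adjacent_neq[OF adj(2)] by (simp add: is_path_def)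
  then have seg: "segment m a c = [a, b, c]" by (rule segment_eq)
  have dab: "tree_dist m a b = edge_length m a b"
    by (rule tree_dist_adjacent[OF v(1,2) adj(1)])
  have dcb: "tree_dist m c b = edge_length m b c"
    using tree_dist_adjacent[OF v(3,2)] adj(2) adjacent_sym edge_length_sym by metis
  have dac: "tree_dist m a c = edge_length m a b + edge_length m b c"
    using tree_dist_split(2)[OF v(1,3), of b] seg dab dcb tree_dist_sym[OF v(2,3)] by simp
  have pos: "tree_dist m a c > 0" by (rule tree_dist_pos[OF assms(1) v(1,3) ac])
  have "u b \<le> tree_dist m c b / tree_dist m a c * u a + tree_dist m a b / tree_dist m a c * u c"
    using assms(2) v ac seg unfolding tree_convex_def by simp
  also have "\<dots> = (edge_length m b c * u a + edge_length m a b * u c) / tree_dist m a c"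
    by (simp add: dab dcb add_divide_distrib)
  finally show "u b * (edge_length m a b + edge_length m b c)
      \<le> edge_length m b c * u a + edge_length m a b * u c"
    using pos unfolding dac by (simp add: pos_le_divide_eq)
qed

text \<open>For a sequence \<open>U\<close> of values at points with gaps \<open>L\<close>, the local inequalities say that the
  slopes \<open>(U (i + 1) - U i) / L i\<close> increase. Hence the slope \<open>s\<close> to the right of point
  \<open>k\<close> is at least the mean slope over \<open>{0..k}\<close> and at most the mean slope over \<open>{k..n}\<close>.\<close>

lemma discrete_convexity_chord:
  fixes U L :: "nat \<Rightarrow> real"
  assumes pos: "\<And>i. L i > 0"
    and loc: "\<And>i. Suc i < n \<Longrightarrow>
      U (Suc i) * (L i + L (Suc i)) \<le> L (Suc i) * U i + L i * U (Suc (Suc i))"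
    and k: "k \<le> n"
  shows "U k * sum L {..<n} \<le> (sum L {..<n} - sum L {..<k}) * U 0 + sum L {..<k} * U n"
proof (cases "k = n")
  case False
  define s where "s i = (U (Suc i) - U i) / L i" for i
  have step: "U (Suc i) - U i = s i * L i" for i
    using pos[of i] by (simp add: s_def)
  have mono1: "s i \<le> s (Suc i)" if "Suc i < n" for i
    using loc[OF that] pos[of i] pos[of "Suc i"]
    by (simp add: s_def divide_le_eq le_divide_eq field_simps)
  have mono: "s i \<le> s j" if "i \<le> j" "j < n" for i j
    using that by (induction j rule: dec_induct) (auto intro: order_trans[OF _ mono1])
  have kn: "k < n" using False k by simp
  have "U k - U 0 = (\<Sum>i<k. U (Suc i) - U i)" by (simp add: sum_lessThan_telescope)
  also have "\<dots> \<le> (\<Sum>i<k. s k * L i)"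
    unfolding step using kn pos by (intro sum_mono mult_right_mono mono) (auto intro: less_imp_le)
  finally have left: "U k - U 0 \<le> s k * sum L {..<k}" by (simp add: sum_distrib_left)
  have "s k * sum L {k..<n} \<le> (\<Sum>i=k..<n. U (Suc i) - U i)"
    unfolding step sum_distrib_left using pos
    by (intro sum_mono mult_right_mono mono) (auto intro: less_imp_le)
  also have "\<dots> = U n - U k" using k by (rule sum_Suc_diff')
  finally have right: "s k * sum L {k..<n} \<le> U n - U k" .
  have split: "sum L {..<n} = sum L {..<k} + sum L {k..<n}"
    using k by (simp add: lessThan_atLeast0 sum.atLeastLessThan_concat)
  have nonneg: "0 \<le> sum L {..<k}" "0 \<le> sum L {k..<n}"
    using pos by (simp_all add: sum_nonneg less_imp_le)
  have "(U k - U 0) * sum L {k..<n} \<le> s k * sum L {..<k} * sum L {k..<n}"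
    by (rule mult_right_mono[OF left nonneg(2)])
  also have "\<dots> \<le> (U n - U k) * sum L {..<k}"
    using mult_right_mono[OF right nonneg(1)] by (simp add: mult_ac)
  finally show ?thesis unfolding split by (simp add: algebra_simps)
qed simp

lemma locally_convex_imp_tree_convex:
  assumes "m > 0" "locally_convex m u"
  shows "tree_convex m u"
  unfolding tree_convex_def
proof (intro ballI impI)
  fix x y z
  assume xy: "x \<in> vertices m" "y \<in> vertices m" "x \<noteq> y" and z: "z \<in> set (segment m x y)"
  obtain p q where pq: "segment m x y = p @ [z] @ q"
    using split_list[OF z] by auto
  define r where "r = p @ [z] @ q"
  define n where "n = length r - 1"
  define L where "L i = edge_length m (r ! i) (r ! Suc i)" for i
  have path: "is_path m x y r" using segment_is_path[OF xy(1,2)] pq by (simp add: r_def)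
  have "is_path m x z (p @ [z])"
    using path unfolding is_path_def r_def
    by (cases p) (auto simp: successively_append_iff successively_Cons hd_append)
  then have "tree_dist m x z = path_length m (p @ [z])"
    by (simp add: tree_dist_def segment_eq)
  also have "\<dots> = sum L {..<length p}"
    unfolding path_length_def L_def r_def by (intro sum.cong) (auto simp: nth_append)
  finally have dxz: "tree_dist m x z = sum L {..<length p}" .
  have dxy: "tree_dist m x y = sum L {..<n}"
    by (simp add: tree_dist_def pq path_length_def L_def n_def r_def)
  have dyz: "tree_dist m y z = sum L {..<n} - sum L {..<length p}"
    using tree_dist_split[OF xy(1,2) z] tree_dist_sym[OF xy(2)] dxz dxy by simp
  have ends: "r ! 0 = x" "r ! n = y" "r ! length p = z" "length p \<le> n"
    using path unfolding is_path_def n_def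
    by (auto simp: r_def hd_conv_nth last_conv_nth nth_append)
  have len: "length r = Suc n" by (simp add: n_def r_def)
  have loc: "u (r ! Suc i) * (L i + L (Suc i)) \<le> L (Suc i) * u (r ! i) + L i * u (r ! Suc (Suc i))"
    if i: "Suc i < n" for i
  proof -
    have "r ! i \<in> vertices m" "r ! Suc i \<in> vertices m" "r ! Suc (Suc i) \<in> vertices m"
      using path i len nth_mem unfolding is_path_def by (auto simp: subset_iff)
    moreover have "adjacent m (r ! i) (r ! Suc i)" "adjacent m (r ! Suc i) (r ! Suc (Suc i))"
      using path i len successively_nth[of "adjacent m" r] unfolding is_path_def by simp_all
    moreover have "r ! i \<noteq> r ! Suc (Suc i)"
      using path i len unfolding is_path_def by (simp add: nth_eq_iff_index_eq)
    ultimately show ?thesis using assms(2) unfolding locally_convex_def L_def by blast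
  qed
  have pos: "tree_dist m x y > 0" by (rule tree_dist_pos[OF assms(1) xy])
  have "u z * tree_dist m x y \<le> tree_dist m y z * u x + tree_dist m x z * u y"
    using discrete_convexity_chord[of L n "\<lambda>i. u (r ! i)", OF _ loc ends(4)]
      edge_length_pos[OF assms(1)] ends
    unfolding dxy dyz dxz by (simp add: L_def)
  then have "u z \<le> (tree_dist m y z * u x + tree_dist m x z * u y) / tree_dist m x y"
    using pos by (simp add: pos_le_divide_eq)
  then show "u z \<le> tree_dist m y z / tree_dist m x y * u x + tree_dist m x z / tree_dist m x y * u y"
    by (simp add: add_divide_distrib)
qed

lemma tree_convex_iff_locally_convex:
  "m > 0 \<Longrightarrow> tree_convex m u \<longleftrightarrow> locally_convex m u"
  using tree_convex_imp_locally_convex locally_convex_imp_tree_convex by blast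

section \<open>Convex functions are the subsolutions of the equation\<close>

definition neighbour_min :: "nat \<Rightarrow> (nat list \<Rightarrow> real) \<Rightarrow> nat list \<Rightarrow> real" where
  "neighbour_min m u x =
     (if x = [] then min_succ_pairs m u x else min (min_succ_pairs m u x) (min_pred_succ m u x))"

lemma solves_equation_iff_neighbour_min:
  "solves_equation m u \<longleftrightarrow> (\<forall>x\<in>vertices m. u x = neighbour_min m u x)"
  by (simp add: solves_equation_def neighbour_min_def)

lemma successors_vertices:
  "x \<in> vertices m \<Longrightarrow> y \<in> successors m x \<Longrightarrow> y \<in> vertices m"
  by (auto simp: successors_def vertices_def)

text \<open>The branching number must be at least 2 for the minimum over pairs of
  successors to range over a nonempty set.\<close>

lemma le_neighbour_min_iff:
  assumes "m \<ge> 2"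
  shows "c \<le> neighbour_min m u x \<longleftrightarrow>
    (\<forall>y\<in>successors m x. \<forall>z\<in>successors m x. y \<noteq> z \<longrightarrow> c \<le> (u y + u z) / 2) \<and>
    (x \<noteq> [] \<longrightarrow> (\<forall>y\<in>successors m x. c \<le> (u (butlast x) + real m * u y) / (real m + 1)))"
proof -
  let ?S = "successors m x"
  let ?A = "{(u y + u z) / 2 | y z. y \<in> ?S \<and> z \<in> ?S \<and> y \<noteq> z}"
  let ?B = "{(u (butlast x) + real m * u y) / (real m + 1) | y. y \<in> ?S}"
  have S: "?S = (\<lambda>i. x @ [i]) ` {..<m}" by (auto simp: successors_def)
  then have fin: "finite ?S" by simp
  have "?A \<subseteq> (\<Union>y\<in>?S. (\<lambda>z. (u y + u z) / 2) ` ?S)" by blast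
  moreover have "finite (\<Union>y\<in>?S. (\<lambda>z. (u y + u z) / 2) ` ?S)" using fin by blast
  ultimately have finA: "finite ?A" by (rule finite_subset)
  have "?B = (\<lambda>y. (u (butlast x) + real m * u y) / (real m + 1)) ` ?S" by auto
  then have finB: "finite ?B" using fin by simp
  have two: "x @ [0] \<in> ?S" "x @ [1] \<in> ?S" using assms by (auto simp: successors_def)
  then have "(u (x @ [0]) + u (x @ [1])) / 2 \<in> ?A" by fastforce
  then have neA: "?A \<noteq> {}" by blast
  have neB: "?B \<noteq> {}" using two(1) by blast
  have "c \<le> min_succ_pairs m u x \<longleftrightarrow> (\<forall>y\<in>?S. \<forall>z\<in>?S. y \<noteq> z \<longrightarrow> c \<le> (u y + u z) / 2)"
    unfolding min_succ_pairs_def Min_ge_iff[OF finA neA] by blast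
  moreover have "c \<le> min_pred_succ m u x \<longleftrightarrow>
      (\<forall>y\<in>?S. c \<le> (u (butlast x) + real m * u y) / (real m + 1))"
    unfolding min_pred_succ_def Min_ge_iff[OF finB neB] by blast
  ultimately show ?thesis unfolding neighbour_min_def by (cases "x = []") simp_all
qed

text \<open>The edge above \<open>x\<close> is \<open>m\<close> times as long as the edges below it, which is where
  the weights \<open>1\<close> and \<open>m\<close> come from.\<close>

lemma locally_convex_iff_neighbour_min:
  assumes "m \<ge> 2"
  shows "locally_convex m u \<longleftrightarrow> (\<forall>x\<in>vertices m. u x \<le> neighbour_min m u x)"
proof -
  have below: "edge_length m x y = 1 / real m ^ Suc (length x)"
    if "y \<in> successors m x" for x y
    using that by (auto simp: edge_length_def successors_def max_def)
  have above: "edge_length m x (butlast x) = real m * (1 / real m ^ Suc (length x))"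
    if "x \<noteq> []" for x
  proof -
    have "max (length x) (length (butlast x)) = length x" by simp
    then show ?thesis using assms by (simp add: edge_length_def)
  qed
  have pair: "u x * (edge_length m y x + edge_length m x z)
        \<le> edge_length m x z * u y + edge_length m y x * u z \<longleftrightarrow> u x \<le> (u y + u z) / 2"
    if "y \<in> successors m x" "z \<in> successors m x" for x y z
  proof -
    define e where "e = 1 / real m ^ Suc (length x)"
    have e: "e > 0" using assms by (simp add: e_def)
    have "u x * (e + e) \<le> e * u y + e * u z \<longleftrightarrow> e * (2 * u x) \<le> e * (u y + u z)"
      by (simp add: algebra_simps)
    also have "\<dots> \<longleftrightarrow> u x \<le> (u y + u z) / 2"
      using e by (subst mult_le_cancel_left_pos) auto
    finally show ?thesis
      using below[OF that(1)] below[OF that(2)] edge_length_sym[of m y x] by (simp add: e_def)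
  qed
  have pred: "u x * (edge_length m (butlast x) x + edge_length m x y)
        \<le> edge_length m x y * u (butlast x) + edge_length m (butlast x) x * u y \<longleftrightarrow>
      u x \<le> (u (butlast x) + real m * u y) / (real m + 1)"
    if "x \<noteq> []" "y \<in> successors m x" for x y
  proof -
    define e where "e = 1 / real m ^ Suc (length x)"
    have e: "e > 0" using assms by (simp add: e_def)
    have "u x * (real m * e + e) \<le> e * u (butlast x) + real m * e * u y \<longleftrightarrow>
        e * (u x * (real m + 1)) \<le> e * (u (butlast x) + real m * u y)"
      by (simp add: algebra_simps)
    also have "\<dots> \<longleftrightarrow> u x \<le> (u (butlast x) + real m * u y) / (real m + 1)"
      using e by (subst mult_le_cancel_left_pos) (auto simp: pos_le_divide_eq)
    finally show ?thesis
      using below[OF that(2)] above[OF that(1)] edge_length_sym[of m "butlast x" x]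
      by (simp add: e_def)
  qed
  show ?thesis
  proof
    assume lc: "locally_convex m u"
    show "\<forall>x\<in>vertices m. u x \<le> neighbour_min m u x"
      unfolding le_neighbour_min_iff[OF assms]
    proof (intro ballI conjI impI)
      fix x y z
      assume "x \<in> vertices m" and yz: "y \<in> successors m x" "z \<in> successors m x" and "y \<noteq> z"
      then show "u x \<le> (u y + u z) / 2"
        using lc successors_vertices[of x m] pair[OF yz]
        unfolding locally_convex_def adjacent_def by blast
    next
      fix x y
      assume x: "x \<in> vertices m" "x \<noteq> []" and y: "y \<in> successors m x"
      have "butlast x \<noteq> y" using y by (auto simp: successors_def dest: arg_cong[of _ _ length])
      moreover have "adjacent m x y" using y by (simp add: adjacent_def)
      ultimately show "u x \<le> (u (butlast x) + real m * u y) / (real m + 1)"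
        using lc x(1) successors_vertices[OF x(1) y] adjacent_butlast[OF x] pred[OF x(2) y]
        unfolding locally_convex_def by (metis adjacent_sym)
    qed
  next
    assume "\<forall>x\<in>vertices m. u x \<le> neighbour_min m u x"
    then have sub: "\<And>x y z. \<lbrakk>x \<in> vertices m; y \<in> successors m x; z \<in> successors m x; y \<noteq> z\<rbrakk>
          \<Longrightarrow> u x \<le> (u y + u z) / 2"
        "\<And>x y. \<lbrakk>x \<in> vertices m; x \<noteq> []; y \<in> successors m x\<rbrakk>
          \<Longrightarrow> u x \<le> (u (butlast x) + real m * u y) / (real m + 1)"
      unfolding le_neighbour_min_iff[OF assms] by blast+
    have up: "b \<noteq> [] \<and> a = butlast b" if "b \<in> successors m a" for a b
      using that by (auto simp: successors_def)
    show "locally_convex m u"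
      unfolding locally_convex_def
    proof (intro ballI impI)
      fix a b c
      assume b: "b \<in> vertices m" and adj: "adjacent m a b" "adjacent m b c" and ac: "a \<noteq> c"
      consider "a \<in> successors m b" "c \<in> successors m b"
        | "b \<noteq> []" "a = butlast b" "c \<in> successors m b"
        | "b \<noteq> []" "c = butlast b" "a \<in> successors m b"
        using adj ac up unfolding adjacent_def by metis
      then show "u b * (edge_length m a b + edge_length m b c)
          \<le> edge_length m b c * u a + edge_length m a b * u c"
      proof cases
        case 1
        then show ?thesis using pair sub(1) b ac by blast
      next
        case 2
        then show ?thesis using pred sub(2) b by blast
      next
        case 3
        then have "u b * (edge_length m c b + edge_length m b a)
            \<le> edge_length m b a * u c + edge_length m c b * u a"
          using pred sub(2) b by blast
        then show ?thesis
          by (simp add: edge_length_sym[of m c b] edge_length_sym[of m b a] add.commute)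
      qed
    qed
  qed
qed

lemma tree_convex_iff_neighbour_min:
  assumes "m \<ge> 2"
  shows "tree_convex m u \<longleftrightarrow> (\<forall>x\<in>vertices m. u x \<le> neighbour_min m u x)"
  using tree_convex_iff_locally_convex locally_convex_iff_neighbour_min assms by simp

text \<open>Only the values at the neighbours of \<open>x\<close> enter; excluding \<open>x\<close> itself from the
  hypothesis is what allows the value at \<open>x\<close> to be changed freely.\<close>

lemma neighbour_min_mono:
  assumes "m \<ge> 2" "x \<in> vertices m" "\<And>y. y \<in> vertices m \<Longrightarrow> y \<noteq> x \<Longrightarrow> u y \<le> v y"
  shows "neighbour_min m u x \<le> neighbour_min m v x"
proof -
  have succ: "u y \<le> v y" if "y \<in> successors m x" for y
    using assms(3) successors_vertices[OF assms(2) that] that by (auto simp: successors_def)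
  have pred: "u (butlast x) \<le> v (butlast x)" if "x \<noteq> []"
    using assms(3) adjacent_butlast[OF assms(2) that] adjacent_neq by metis
  have *: "(\<forall>y\<in>successors m x. \<forall>z\<in>successors m x. y \<noteq> z \<longrightarrow>
        neighbour_min m u x \<le> (u y + u z) / 2) \<and>
      (x \<noteq> [] \<longrightarrow> (\<forall>y\<in>successors m x.
        neighbour_min m u x \<le> (u (butlast x) + real m * u y) / (real m + 1)))"
    using le_neighbour_min_iff[OF assms(1)] by blast
  show ?thesis
    unfolding le_neighbour_min_iff[OF assms(1), of _ v]
  proof (intro conjI ballI impI)
    fix y z assume yz: "y \<in> successors m x" "z \<in> successors m x" "y \<noteq> z"
    then have "neighbour_min m u x \<le> (u y + u z) / 2" using * by blast
    also have "\<dots> \<le> (v y + v z) / 2" using succ[OF yz(1)] succ[OF yz(2)] by simp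
    finally show "neighbour_min m u x \<le> (v y + v z) / 2" .
  next
    fix y assume x: "x \<noteq> []" and y: "y \<in> successors m x"
    then have "neighbour_min m u x \<le> (u (butlast x) + real m * u y) / (real m + 1)"
      using * by blast
    also have "\<dots> \<le> (v (butlast x) + real m * v y) / (real m + 1)"
      using pred[OF x] succ[OF y] by (intro divide_right_mono add_mono mult_left_mono) auto
    finally show "neighbour_min m u x \<le> (v (butlast x) + real m * v y) / (real m + 1)" .
  qed
qed

section \<open>Boundary values\<close>

lemma length_branch_vertex [simp]: "length (branch_vertex \<pi> k) = k"
  by (simp add: branch_vertex_def)

lemma branch_vertex_Suc: "branch_vertex \<pi> (Suc k) = branch_vertex \<pi> k @ [\<pi> k]"
  by (simp add: branch_vertex_def)

lemma branch_vertex_in_vertices: "\<pi> \<in> branches m \<Longrightarrow> branch_vertex \<pi> k \<in> vertices m"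
  by (auto simp: branch_vertex_def branches_def vertices_def)

text \<open>Removing the first \<open>k\<close> digits and rescaling leaves the number \<open>psi\<close> of the shifted branch,
  which lies in \<open>{0..1}\<close>.\<close>

lemma psi_diff_le:
  assumes "m \<ge> 2" "\<pi> \<in> branches m" "\<beta> \<in> branches m" "branch_vertex \<pi> k = branch_vertex \<beta> k"
  shows "\<bar>psi m \<beta> - psi m \<pi>\<bar> \<le> (1 / real m) ^ k"
proof -
  have split: "psi m \<alpha> = (1 / real m) ^ k * psi m (\<lambda>i. \<alpha> (i + k))
        + (\<Sum>i<k. real (\<alpha> i) / real m ^ Suc i)"
      "psi m (\<lambda>i. \<alpha> (i + k)) \<in> {0..1}"
    if "\<alpha> \<in> branches m" for \<alpha>
  proof -
    have shift: "(\<lambda>i. \<alpha> (i + k)) \<in> branches m" using that by (simp add: branches_def)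
    then show "psi m (\<lambda>i. \<alpha> (i + k)) \<in> {0..1}" by (rule psi_in_unit(2)[OF assms(1)])
    have "(\<Sum>i. real (\<alpha> (i + k)) / real m ^ Suc (i + k))
        = (\<Sum>i. (1 / real m) ^ k * (real (\<alpha> (i + k)) / real m ^ Suc i))"
      by (simp add: power_add power_inverse divide_inverse mult_ac)
    also have "\<dots> = (1 / real m) ^ k * psi m (\<lambda>i. \<alpha> (i + k))"
      unfolding psi_def by (rule suminf_mult[OF psi_in_unit(1)[OF assms(1) shift]])
    finally show "psi m \<alpha> = (1 / real m) ^ k * psi m (\<lambda>i. \<alpha> (i + k))
        + (\<Sum>i<k. real (\<alpha> i) / real m ^ Suc i)"
      using suminf_split_initial_segment[OF psi_in_unit(1)[OF assms(1) that], of k]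
      by (simp add: psi_def)
  qed
  have "\<pi> i = \<beta> i" if "i < k" for i
    using assms(4) that by (simp add: branch_vertex_def)
  then have "(\<Sum>i<k. real (\<pi> i) / real m ^ Suc i) = (\<Sum>i<k. real (\<beta> i) / real m ^ Suc i)"
    by simp
  then have "psi m \<beta> - psi m \<pi>
      = (1 / real m) ^ k * (psi m (\<lambda>i. \<beta> (i + k)) - psi m (\<lambda>i. \<pi> (i + k)))"
    using split(1)[OF assms(2)] split(1)[OF assms(3)] by (simp add: algebra_simps)
  moreover have "\<bar>psi m (\<lambda>i. \<beta> (i + k)) - psi m (\<lambda>i. \<pi> (i + k))\<bar> \<le> 1"
    using split(2)[OF assms(2)] split(2)[OF assms(3)] by auto
  ultimately show ?thesis by (simp add: abs_mult mult_left_le)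
qed

text \<open>Since \<open>u x\<close> is at most the mean of \<open>u\<close> over two successors, one of them has a value
  at least as large. Iterating this choice from \<open>x\<close> yields a branch along which \<open>u\<close> stays
  above \<open>u x\<close>.\<close>

lemma convex_minorant_le_boundary_value:
  assumes m: "m \<ge> 2" and u: "u \<in> convex_minorants m g" and x: "x \<in> vertices m"
  obtains \<beta> where "\<beta> \<in> branches m" "branch_vertex \<beta> (length x) = x" "u x \<le> g (psi m \<beta>)"
proof -
  have "\<exists>i<m. u y \<le> u (y @ [i])" if y: "y \<in> vertices m" for y
  proof -
    have "u y \<le> neighbour_min m u y"
      using u y tree_convex_iff_neighbour_min[OF m] by (simp add: convex_minorants_def)
    moreover have "y @ [0] \<in> successors m y" "y @ [Suc 0] \<in> successors m y"
      using m by (auto simp: successors_def)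
    ultimately have "u y \<le> (u (y @ [0]) + u (y @ [Suc 0])) / 2"
      unfolding le_neighbour_min_iff[OF m] by simp
    then have "u y \<le> u (y @ [0]) \<or> u y \<le> u (y @ [Suc 0])" by argo
    moreover have "0 < m" "Suc 0 < m" using m by auto
    ultimately show ?thesis by blast
  qed
  then obtain d where d: "\<And>y. y \<in> vertices m \<Longrightarrow> d y < m \<and> u y \<le> u (y @ [d y])"
    by metis
  define v where "v n = ((\<lambda>y. y @ [d y]) ^^ n) x" for n
  have v0: "v 0 = x" and vS: "v (Suc n) = v n @ [d (v n)]" for n
    by (simp_all add: v_def)
  have v: "v n \<in> vertices m \<and> u x \<le> u (v n)" for n
  proof (induction n)
    case (Suc n)
    then have "d (v n) < m" "u (v n) \<le> u (v n @ [d (v n)])" using d by blast+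
    then show ?case using Suc by (auto simp: vS vertices_def)
  qed (simp add: v0 x)
  define \<beta> where "\<beta> k = (if k < length x then x ! k else d (v (k - length x)))" for k
  have \<beta>: "\<beta> \<in> branches m"
    using v d x nth_mem[of _ x] by (auto simp: branches_def \<beta>_def vertices_def subset_iff)
  have bx: "branch_vertex \<beta> (length x) = x"
    by (intro nth_equalityI) (auto simp: branch_vertex_def \<beta>_def)
  have \<beta>d: "\<beta> (length x + n) = d (v n)" for n by (simp add: \<beta>_def)
  have bv: "branch_vertex \<beta> (length x + n) = v n" for n
    by (induction n) (simp_all add: bx v0 vS branch_vertex_Suc \<beta>d)
  have "u x \<le> u (branch_vertex \<beta> k)" if "k \<ge> length x" for k
    using v[of "k - length x"] bv[of "k - length x"] that by simp
  then have "eventually (\<lambda>k. ereal (u x) \<le> ereal (u (branch_vertex \<beta> k))) sequentially"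
    by (auto simp: eventually_sequentially)
  then have "ereal (u x) \<le> limsup (\<lambda>k. ereal (u (branch_vertex \<beta> k)))"
    by (intro le_Limsup) auto
  also have "\<dots> \<le> ereal (g (psi m \<beta>))"
    using u \<beta> by (simp add: convex_minorants_def boundary_le_def)
  finally have "u x \<le> g (psi m \<beta>)" by simp
  then show thesis using that \<beta> bx by blast
qed

text \<open>A branch passes through a given vertex only once.\<close>

lemma boundary_le_fun_upd:
  assumes "boundary_le m g u"
  shows "boundary_le m g (u(x := c))"
proof -
  have "limsup (\<lambda>k. ereal ((u(x := c)) (branch_vertex \<pi> k)))
      = limsup (\<lambda>k. ereal (u (branch_vertex \<pi> k)))" for \<pi>
  proof (rule Limsup_eq)
    have "branch_vertex \<pi> k \<noteq> x" if "k > length x" for k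
      using that by auto
    then show "eventually (\<lambda>k. ereal ((u(x := c)) (branch_vertex \<pi> k))
        = ereal (u (branch_vertex \<pi> k))) sequentially"
      by (intro eventually_mono[OF eventually_gt_at_top[of "length x"]]) simp
  qed
  then show ?thesis using assms by (simp add: boundary_le_def)
qed

section \<open>Perron's method\<close>

lemma le_convex_envelope:
  assumes "m \<ge> 2" "continuous_on {0..1} g" "u \<in> convex_minorants m g" "x \<in> vertices m"
  shows "u x \<le> convex_envelope m g x"
  unfolding convex_envelope_def
  by (rule cSUP_upper[OF assms(3) convex_minorants_bdd_above[OF assms(1,2,4)]])

lemma convex_envelope_tree_convex:
  assumes "m \<ge> 2" "continuous_on {0..1} g"
  shows "tree_convex m (convex_envelope m g)"
  unfolding tree_convex_iff_neighbour_min[OF assms(1)]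
proof
  fix x assume x: "x \<in> vertices m"
  have "u x \<le> neighbour_min m (convex_envelope m g) x" if u: "u \<in> convex_minorants m g" for u
  proof -
    have "u x \<le> neighbour_min m u x"
      using u x tree_convex_iff_neighbour_min[OF assms(1)] by (simp add: convex_minorants_def)
    also have "\<dots> \<le> neighbour_min m (convex_envelope m g) x"
      using neighbour_min_mono[OF assms(1) x] le_convex_envelope[OF assms u] by blast
    finally show ?thesis .
  qed
  then show "convex_envelope m g x \<le> neighbour_min m (convex_envelope m g) x"
    unfolding convex_envelope_def[of m g x]
    by (intro cSUP_least convex_minorants_nonempty[OF assms])
qed

text \<open>Near a branch \<open>\<pi>\<close> every competitor is bounded by a value of \<open>g\<close> at a point close to
  \<open>psi m \<pi>\<close>; the closeness depends only on the level, so the bound passes to the supremum.\<close>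

lemma convex_envelope_boundary_le:
  assumes "m \<ge> 2" "continuous_on {0..1} g"
  shows "boundary_le m g (convex_envelope m g)"
  unfolding boundary_le_def
proof (intro ballI, rule ereal_le_epsilon2)
  fix \<pi> and e :: real
  assume \<pi>: "\<pi> \<in> branches m" and e: "e > 0"
  obtain \<delta> where \<delta>: "\<delta> > 0"
      "\<And>t. t \<in> {0..1} \<Longrightarrow> \<bar>t - psi m \<pi>\<bar> < \<delta> \<Longrightarrow> \<bar>g t - g (psi m \<pi>)\<bar> < e"
    using bspec[OF assms(2)[unfolded continuous_on_iff] psi_in_unit(2)[OF assms(1) \<pi>]] e
    unfolding dist_real_def by blast
  have "(\<lambda>k. (1 / real m) ^ k) \<longlonglongrightarrow> 0"
    using assms(1) by (intro LIMSEQ_realpow_zero) auto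
  then have "eventually (\<lambda>k. (1 / real m) ^ k < \<delta>) sequentially"
    using \<delta>(1) by (rule order_tendstoD)
  then have "eventually (\<lambda>k. ereal (convex_envelope m g (branch_vertex \<pi> k))
      \<le> ereal (g (psi m \<pi>)) + ereal e) sequentially"
  proof (rule eventually_mono)
    fix k assume k: "(1 / real m) ^ k < \<delta>"
    let ?x = "branch_vertex \<pi> k"
    have "u ?x \<le> g (psi m \<pi>) + e" if u: "u \<in> convex_minorants m g" for u
    proof -
      obtain \<beta> where \<beta>: "\<beta> \<in> branches m" "branch_vertex \<beta> k = ?x" "u ?x \<le> g (psi m \<beta>)"
        by (rule convex_minorant_le_boundary_value[OF assms(1) u
              branch_vertex_in_vertices[OF \<pi>, of k], unfolded length_branch_vertex])
      have "\<bar>psi m \<beta> - psi m \<pi>\<bar> < \<delta>"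
        using psi_diff_le[OF assms(1) \<pi> \<beta>(1) \<beta>(2)[symmetric]] k by linarith
      then have "\<bar>g (psi m \<beta>) - g (psi m \<pi>)\<bar> < e"
        using \<delta>(2) psi_in_unit(2)[OF assms(1) \<beta>(1)] by blast
      then show ?thesis using \<beta>(3) by linarith
    qed
    then have "convex_envelope m g ?x \<le> g (psi m \<pi>) + e"
      unfolding convex_envelope_def by (intro cSUP_least convex_minorants_nonempty[OF assms])
    then show "ereal (convex_envelope m g ?x) \<le> ereal (g (psi m \<pi>)) + ereal e" by simp
  qed
  then show "limsup (\<lambda>k. ereal (convex_envelope m g (branch_vertex \<pi> k)))
      \<le> ereal (g (psi m \<pi>)) + ereal e"
    by (rule Limsup_bounded)
qed

text \<open>The competitor \<open>v\<close> raises the envelope at \<open>x\<close> to the right-hand side of the equation.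
  It remains a subsolution at \<open>x\<close> because the right-hand side there is unchanged, and at
  the other vertices because their right-hand sides can only increase.\<close>

lemma convex_envelope_solves_equation:
  assumes "m \<ge> 2" "continuous_on {0..1} g"
  shows "solves_equation m (convex_envelope m g)"
  unfolding solves_equation_iff_neighbour_min
proof
  fix x assume x: "x \<in> vertices m"
  define w where "w = convex_envelope m g"
  define v where "v = w(x := neighbour_min m w x)"
  have sub: "w y \<le> neighbour_min m w y" if "y \<in> vertices m" for y
    using convex_envelope_tree_convex[OF assms] tree_convex_iff_neighbour_min[OF assms(1)] that
    by (simp add: w_def)
  have "v y \<le> neighbour_min m v y" if y: "y \<in> vertices m" for y
  proof -
    have "v y \<le> neighbour_min m w y" using sub[OF y] by (simp add: v_def)
    also have "\<dots> \<le> neighbour_min m v y"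
      using sub[OF x] by (intro neighbour_min_mono[OF assms(1) y]) (simp add: v_def)
    finally show ?thesis .
  qed
  then have "tree_convex m v" using tree_convex_iff_neighbour_min[OF assms(1)] by blast
  moreover have "boundary_le m g v"
    unfolding v_def w_def by (intro boundary_le_fun_upd convex_envelope_boundary_le[OF assms])
  ultimately have "v x \<le> w x"
    unfolding w_def by (intro le_convex_envelope[OF assms _ x]) (simp add: convex_minorants_def)
  then have "w x = neighbour_min m w x" using sub[OF x] by (simp add: v_def)
  then show "convex_envelope m g x = neighbour_min m (convex_envelope m g) x"
    by (simp add: w_def)
qed

theorem theorem1p1:
  fixes m :: nat and g :: "real \<Rightarrow> real"
  assumes "m \<ge> 2"
    and "continuous_on {0..1} g"
  shows "solves_equation m (convex_envelope m g)
    \<and> boundary_le m g (convex_envelope m g)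
    \<and> (\<forall>u. solves_equation m u \<and> boundary_le m g u \<longrightarrow>
          (\<forall>x\<in>vertices m. u x \<le> convex_envelope m g x))"
proof (intro conjI allI impI ballI)
  show "solves_equation m (convex_envelope m g)"
    by (rule convex_envelope_solves_equation[OF assms])
  show "boundary_le m g (convex_envelope m g)"
    by (rule convex_envelope_boundary_le[OF assms])
next
  fix u x
  assume u: "solves_equation m u \<and> boundary_le m g u" and x: "x \<in> vertices m"
  have "tree_convex m u"
    using u unfolding tree_convex_iff_neighbour_min[OF assms(1)] solves_equation_iff_neighbour_min
    by simp
  then have "u \<in> convex_minorants m g" using u by (simp add: convex_minorants_def)
  then show "u x \<le> convex_envelope m g x" using x by (rule le_convex_envelope[OF assms])
qed

end
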